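(* Every complete all-set-homogeneous length space is geodesic.
   Context: An isometry is a bijective distance-preserving map. A metric space $M$ is all-set-homogeneous if every isometry between two subsets of $M$ extends to an isometry $M\to M$. A metric space is a length space if the distance between any two points is the infimum of the lengths of curves joining them. A geodesic in $M$ is a distance-preserving map from a real interval to $M$. $M$ is geodesic if any two points are the endpoints of some geodesic. *)

theory Defs
  imports "HOL-Analysis.Analysis"
begin

text \<open>
  A metric space is given as a subset \<open>M\<close> of a type of class \<open>metric_space\<close>, with the
  restricted distance; \<open>M = UNIV\<close> is the case of a whole type.
\<close>

definition distance_preserving_on ::
    "'a::metric_space set \<Rightarrow> ('a \<Rightarrow> 'b::metric_space) \<Rightarrow> bool" where
  "distance_preserving_on A f \<longleftrightarrow> (\<forall>x\<in>A. \<forall>y\<in>A. dist (f x) (f y) = dist x y)"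

definition isometry_betw ::
    "('a::metric_space \<Rightarrow> 'b::metric_space) \<Rightarrow> 'a set \<Rightarrow> 'b set \<Rightarrow> bool" where
  "isometry_betw f A B \<longleftrightarrow> bij_betw f A B \<and> distance_preserving_on A f"

definition all_set_homogeneous :: "'a::metric_space set \<Rightarrow> bool" where
  "all_set_homogeneous M \<longleftrightarrow>
     (\<forall>A B f. A \<subseteq> M \<and> B \<subseteq> M \<and> isometry_betw f A B \<longrightarrow>
        (\<exists>F. isometry_betw F M M \<and> (\<forall>x\<in>A. F x = f x)))"

text \<open>
  Length of a curve parametrised by \<open>[0, 1]\<close>: the supremum of the lengths of inscribed polygonal
  chains, possibly infinite. The sorted list \<open>ts\<close> holds the parameter values of the chain.
\<close>

definition curve_length :: "(real \<Rightarrow> 'a::metric_space) \<Rightarrow> ennreal" where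
  "curve_length g =
     (SUP ts\<in>{ts. sorted ts \<and> set ts \<subseteq> {0..1}}.
        \<Sum>i<length ts - 1. ennreal (dist (g (ts ! i)) (g (ts ! Suc i))))"

text \<open>
  The infimum over no curves is \<open>\<infinity>\<close>, so any two points of a length space are joined by a curve
  (of finite length).
\<close>

definition length_space :: "'a::metric_space set \<Rightarrow> bool" where
  "length_space M \<longleftrightarrow>
     (\<forall>x\<in>M. \<forall>y\<in>M. ennreal (dist x y) =
        (INF g\<in>{g. path g \<and> path_image g \<subseteq> M \<and> pathstart g = x \<and> pathfinish g = y}.
           curve_length g))"

definition geodesic_on :: "real set \<Rightarrow> (real \<Rightarrow> 'a::metric_space) \<Rightarrow> 'a set \<Rightarrow> bool" where
  "geodesic_on I g M \<longleftrightarrow> is_interval I \<and> g ` I \<subseteq> M \<and> distance_preserving_on I g"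

definition geodesic_space :: "'a::metric_space set \<Rightarrow> bool" where
  "geodesic_space M \<longleftrightarrow>
     (\<forall>x\<in>M. \<forall>y\<in>M. \<exists>a b g. a \<le> b \<and> geodesic_on {a..b} g M \<and> g a = x \<and> g b = y)"

end

theory Submission
  imports Defs
begin

text \<open>
  By Zorn's lemma and completeness it is enough to find, for \<open>x \<noteq> y\<close>, a third point of excess
  zero, where the excess of \<open>z\<close> over \<open>x, y\<close> is \<open>dist x z + dist z y - dist x y\<close>.

  Let \<open>0 < t < dist x y\<close>. Suppose first that points of small excess at distance about \<open>t\<close> from
  \<open>x\<close> have, at every scale \<open>l\<close>, points within \<open>l\<close> whose excess is bounded below. In the plane
  with coordinates distance from \<open>x\<close> and excess, an almost shortest path from \<open>x\<close> through a given
  point \<open>r\<close> of small excess to \<open>y\<close> must cross the path from a much better point \<open>p\<close> to a bad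
  neighbour of \<open>p\<close>. A crossing is a pair of points with the same distances to \<open>x\<close> and \<open>y\<close>, so
  homogeneity carries \<open>p\<close> close to \<open>r\<close>. Iterating gives a Cauchy sequence with excess tending to
  zero.

  Otherwise every \<open>t\<close> is tight: small excess spreads to a ball of definite radius, hence along
  every path that avoids \<open>x\<close> and \<open>y\<close>. If no third point has excess zero, then almost shortest
  paths from points \<open>p\<close> of tiny excess to a fixed point must pass near \<open>x\<close> or \<open>y\<close>. So for \<open>q\<close>
  with \<open>dist x q = dist x y / 2\<close>, the point \<open>x\<close> has tiny excess over \<open>q\<close> and a suitable \<open>p\<close>,
  and tightness forces all \<open>v\<close> near \<open>x\<close> to satisfy \<open>dist q v = dist x q - dist x v\<close>. By
  homogeneity this holds for every such \<open>q\<close>, yet it fails for an almost midpoint of \<open>x\<close> and \<open>y\<close>.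
\<close>

section \<open>Excess and a Cauchy criterion\<close>

definition excess :: "'a::metric_space \<Rightarrow> 'a \<Rightarrow> 'a \<Rightarrow> real" where
  "excess x y z = dist x z + dist z y - dist x y"

lemma excess_nonneg: "0 \<le> excess x y z"
  unfolding excess_def using dist_triangle[of x y z] by simp

lemma Cauchy_if_dist_Suc_le_geometric:
  fixes s :: "nat \<Rightarrow> 'a::metric_space"
  assumes step: "\<And>n. dist (s n) (s (Suc n)) \<le> c * (1/2) ^ n"
  shows "Cauchy s"
proof -
  \<comment> \<open>The right-hand side is the sum of \<open>c * (1/2) ^ i\<close> over
    \<open>N \<le> i < N + k\<close> in closed form.\<close>
  have bound: "dist (s N) (s (N + k)) \<le> 2 * c * (1/2) ^ N - 2 * c * (1/2) ^ (N + k)" for N k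
  proof (induction k)
    case (Suc k)
    have "dist (s N) (s (N + Suc k)) \<le> dist (s N) (s (N + k)) + dist (s (N + k)) (s (Suc (N + k)))"
      using dist_triangle by simp
    moreover have "2 * c * (1/2) ^ (N + Suc k) = c * (1/2) ^ (N + k)"
      by simp
    ultimately show ?case
      using Suc step[of "N + k"] by linarith
  qed simp
  have c: "0 \<le> c"
    using step[of 0] zero_le_dist[of "s 0" "s (Suc 0)"] by (simp del: zero_le_dist)
  have lim: "(\<lambda>N. 2 * c * (1/2) ^ N) \<longlonglongrightarrow> 2 * c * 0"
    by (intro tendsto_mult tendsto_const LIMSEQ_power_zero) simp
  show ?thesis
    unfolding Cauchy_altdef2
  proof (intro allI impI)
    fix e :: real
    assume "0 < e"
    then obtain N where N: "2 * c * (1/2) ^ N < e"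
      using order_tendstoD(2)[OF lim, of e] by (auto simp: eventually_sequentially)
    have "dist (s n) (s N) < e" if "N \<le> n" for n
    proof -
      obtain k where n: "n = N + k"
        using \<open>N \<le> n\<close> le_Suc_ex by blast
      have "0 \<le> 2 * c * (1/2) ^ (N + k)"
        using c by simp
      then show ?thesis
        using bound[of N k] N unfolding n by (simp add: dist_commute)
    qed
    then show "\<exists>N. \<forall>n\<ge>N. dist (s n) (s N) < e"
      by blast
  qed
qed

section \<open>Homogeneity and almost shortest paths\<close>

text \<open>The forms in which homogeneity and the length condition enter: self-maps of
  \<open>M\<close>, and paths all of whose points have excess below \<open>e\<close> over their
  ends.\<close>

locale homogeneous_length_space =
  fixes M :: "'a::metric_space set"
  assumes complete: "complete M"
    and extension: "\<And>A f. A \<subseteq> M \<Longrightarrow> f ` A \<subseteq> M \<Longrightarrow> distance_preserving_on A f \<Longrightarrow>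
      \<exists>F. F ` M \<subseteq> M \<and> distance_preserving_on M F \<and> (\<forall>x\<in>A. F x = f x)"
    and almost_geodesic: "\<And>x y e. x \<in> M \<Longrightarrow> y \<in> M \<Longrightarrow> 0 < e \<Longrightarrow>
      \<exists>g. path g \<and> path_image g \<subseteq> M \<and> pathstart g = x \<and> pathfinish g = y \<and>
        (\<forall>z\<in>path_image g. dist x z + dist z y < dist x y + e)"
begin

lemma pair_homogeneous:
  assumes "x \<in> M" "y \<in> M" "x' \<in> M" "y' \<in> M" "dist x y = dist x' y'"
  obtains F where "\<And>u. u \<in> M \<Longrightarrow> F u \<in> M"
    "\<And>u v. u \<in> M \<Longrightarrow> v \<in> M \<Longrightarrow> dist (F u) (F v) = dist u v" "F x = x'" "F y = y'"
proof -
  define f where "f = (\<lambda>u. if u = x then x' else y')"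
  \<comment> \<open>In the degenerate case \<open>x = y\<close>, \<open>f y\<close> is
    \<open>x'\<close>, which must then be \<open>y'\<close>.\<close>
  have "x = y \<longleftrightarrow> x' = y'"
    using assms(5) by (metis dist_eq_0_iff)
  then have "distance_preserving_on {x, y} f" "f y = y'"
    using assms by (auto simp: distance_preserving_on_def f_def dist_commute)
  moreover have "{x, y} \<subseteq> M" "f ` {x, y} \<subseteq> M"
    using assms by (auto simp: f_def)
  ultimately obtain F where F: "F ` M \<subseteq> M" "distance_preserving_on M F" "\<forall>u\<in>{x, y}. F u = f u"
    using extension by metis
  show ?thesis
    by (rule that[of F]) (use F \<open>f y = y'\<close> in \<open>auto simp: distance_preserving_on_def f_def\<close>)
qed

lemma triple_homogeneous:
  assumes "x \<in> M" "y \<in> M" "z \<in> M" "z' \<in> M" "dist x z = dist x z'" "dist z y = dist z' y"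
  obtains F where "\<And>u. u \<in> M \<Longrightarrow> F u \<in> M"
    "\<And>u v. u \<in> M \<Longrightarrow> v \<in> M \<Longrightarrow> dist (F u) (F v) = dist u v" "F x = x" "F y = y" "F z = z'"
proof -
  define f where "f = (\<lambda>u. if u = z then z' else u)"
  have eq: "x = z \<longleftrightarrow> x = z'" "y = z \<longleftrightarrow> y = z'"
    using assms(5,6) by (metis dist_eq_0_iff)+
  then have "distance_preserving_on {x, y, z} f" "f x = x" "f y = y"
    using assms by (auto simp: distance_preserving_on_def f_def dist_commute)
  moreover have "{x, y, z} \<subseteq> M" "f ` {x, y, z} \<subseteq> M"
    using assms by (auto simp: f_def)
  ultimately obtain F where F: "F ` M \<subseteq> M" "distance_preserving_on M F"
      "\<forall>u\<in>{x, y, z}. F u = f u"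
    using extension by metis
  show ?thesis
    by (rule that[of F]) (use F \<open>f x = x\<close> \<open>f y = y\<close> in \<open>auto simp: distance_preserving_on_def f_def\<close>)
qed

text \<open>Intermediate value theorem for the distance to \<open>q\<close> along an almost shortest
  path. The centre \<open>q\<close> may be a third point, as in \<open>slide_between\<close> and
  \<open>not_all_tight\<close>.\<close>

lemma almost_geodesic_level:
  assumes "x \<in> M" "y \<in> M" "0 < e" "dist q x \<le> t" "t \<le> dist q y"
  obtains z where "z \<in> M" "dist q z = t" "dist x z + dist z y < dist x y + e"
proof -
  obtain g where g: "path g" "path_image g \<subseteq> M" "pathstart g = x" "pathfinish g = y"
      "\<forall>z\<in>path_image g. dist x z + dist z y < dist x y + e"
    using almost_geodesic assms by metis
  have "continuous_on {0..1} (\<lambda>s. dist q (g s))"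
    using g(1) unfolding path_def by (intro continuous_intros)
  then obtain s where "0 \<le> s" "s \<le> 1" "dist q (g s) = t"
    using IVT'[of "\<lambda>s. dist q (g s)" 0 t 1] assms g(3,4) by (auto simp: pathstart_def pathfinish_def)
  moreover from this have "g s \<in> path_image g"
    by (auto simp: path_image_def)
  ultimately show ?thesis
    using that g(2,5) by blast
qed

lemma almost_between:
  assumes "x \<in> M" "y \<in> M" "0 < e" "0 \<le> t" "t \<le> dist x y"
  obtains z where "z \<in> M" "dist x z = t" "excess x y z < e"
proof -
  obtain z where "z \<in> M" "dist x z = t" "dist x z + dist z y < dist x y + e"
    using almost_geodesic_level[of x y e x t] assms by auto
  then show ?thesis
    using that[of z] by (simp add: excess_def)
qed

text \<open>Moving from \<open>z\<close> along an almost shortest path, towards \<open>x\<close> or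
  towards \<open>y\<close>, raises the excess by less than \<open>e\<close>; so \<open>z\<close> can
  be pushed to a prescribed level at controlled cost.\<close>

lemma slide_between:
  assumes "x \<in> M" "y \<in> M" "z \<in> M" "0 < e" "0 \<le> t" "t \<le> dist x y"
  obtains p where "p \<in> M" "dist x p = t" "excess x y p < excess x y z + e"
    "dist z p < \<bar>dist x z - t\<bar> + excess x y z + e"
proof (cases "t \<le> dist x z")
  case True
  obtain p where p: "p \<in> M" "dist x p = t" "dist x p + dist p z < dist x z + e"
    using almost_geodesic_level[of x z e x t] assms True by auto
  show ?thesis
    by (rule that[OF p(1,2)])
      (use p True dist_triangle[of p y z] excess_nonneg[of x y z] in
        \<open>auto simp: excess_def dist_commute\<close>)
next
  case False
  obtain p where p: "p \<in> M" "dist x p = t" "dist z p + dist p y < dist z y + e"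
    using almost_geodesic_level[of z y e x t] assms False by auto
  show ?thesis
    by (rule that[OF p(1,2)])
      (use p False dist_triangle[of x y p] dist_triangle[of x p z] in
        \<open>auto simp: excess_def dist_commute\<close>)
qed

section \<open>Improving a point by a crossing of plane curves\<close>

text \<open>The path through \<open>r\<close> stays below excess \<open>e\<close>, while the path
  from \<open>p\<close> climbs above \<open>e\<close> at \<open>q\<close>. Either the two cross, and
  an isometry fixing \<open>x\<close> and \<open>y\<close> moves \<open>p\<close> near
  \<open>r\<close>, or the first path passes below \<open>p\<close>, and its own point at level
  \<open>dist x p\<close> serves as \<open>p'\<close>.\<close>

lemma improve_between:
  assumes M: "x \<in> M" "y \<in> M" "r \<in> M" "p \<in> M" "q \<in> M"
    and l: "0 < l" "dist p q \<le> l" "dist x p + 2 * l < dist x y"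
    and ex: "excess x y r < e" "e < excess x y q"
  obtains p' where "p' \<in> M" "dist x p' = dist x p" "excess x y p' \<le> excess x y p"
    "dist r p' \<le> \<bar>dist x p - dist x r\<bar> + excess x y r + 5 * l"
proof -
  \<comment> \<open>Detours of less than \<open>d\<close> keep the excess on the path through
    \<open>r\<close> below \<open>e\<close> and cost at most \<open>l\<close>.\<close>
  define d where "d = min l (e - excess x y r)"
  have d: "0 < d" "d \<le> l" "excess x y r + d \<le> e"
    using l ex by (auto simp: d_def)
  have e: "0 < e"
    using ex(1) excess_nonneg[of x y r] by simp
  obtain gx where gx: "path gx" "path_image gx \<subseteq> M" "pathstart gx = x" "pathfinish gx = r"
      "\<forall>z\<in>path_image gx. dist x z + dist z r < dist x r + d"
    using almost_geodesic[of x r d] M d by auto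
  obtain gy where gy: "path gy" "path_image gy \<subseteq> M" "pathstart gy = r" "pathfinish gy = y"
      "\<forall>z\<in>path_image gy. dist r z + dist z y < dist r y + d"
    using almost_geodesic[of r y d] M d by auto
  obtain h where h: "path h" "path_image h \<subseteq> M" "pathstart h = p" "pathfinish h = q"
      "\<forall>z\<in>path_image h. dist p z + dist z q < dist p q + l"
    using almost_geodesic[of p q l] M l by auto
  define g where "g = gx +++ gy"
  have g: "path g" "path_image g \<subseteq> M" "pathstart g = x" "pathfinish g = y"
    "path_image g = path_image gx \<union> path_image gy"
    using gx gy by (auto simp: g_def path_image_join)
  have g_ex: "excess x y z < e" if "z \<in> path_image g" for z
    using that gx(5) gy(5) g(5) d dist_triangle[of z y r] dist_triangle[of x z r]
    unfolding excess_def by (fastforce simp: dist_commute)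
  \<comment> \<open>On an almost shortest path, the distance to \<open>r\<close> is nearly the
    change of level; on the part towards \<open>y\<close> this costs the excess of
    \<open>r\<close>.\<close>
  have g_near: "dist r z < \<bar>dist x z - dist x r\<bar> + excess x y r + d" if "z \<in> path_image g" for z
    using that gx(5) gy(5) g(5) dist_triangle[of x y z] excess_nonneg[of x y r]
    unfolding excess_def by (fastforce simp: dist_commute)
  define pt :: "real \<Rightarrow> real \<Rightarrow> real^2" where "pt u v = (\<chi> i. if i = 1 then u else v)" for u v
  have pt [simp]: "pt u v $ 1 = u" "pt u v $ 2 = v" for u v
    by (simp_all add: pt_def)
  have pt_eq: "pt u v = pt u' v' \<longleftrightarrow> u = u' \<and> v = v'" for u v u' v'
    by (metis pt)
  have cont_pt: "continuous_on S (\<lambda>t. pt (u t) (v t))"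
    if "continuous_on S u" "continuous_on S v" for S :: "real set" and u v
    unfolding pt_def
  proof (rule continuous_on_vec_lambda)
    show "continuous_on S (\<lambda>t. if i = 1 then u t else v t)" for i :: 2
      using that by (cases "i = 1") auto
  qed
  have box: "pt u v \<in> cbox (pt a b) (pt c d) \<longleftrightarrow> a \<le> u \<and> u \<le> c \<and> b \<le> v \<and> v \<le> d" for a b c d u v
    by (auto simp: mem_box_cart forall_2)
  txt \<open>Truncation puts both curves in the box of \<open>fashoda\<close>; it is inactive where they cross.
    The vertical segment \<open>V\<close> covers the case that the first curve passes below \<open>p\<close>.\<close>
  define G where "G = (\<lambda>t. pt (min (dist x y) (dist x (g t))) (excess x y (g t)))"
  define H where "H = (\<lambda>t. pt (dist x (h t)) (min e (excess x y (h t))))"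
  define V where "V = linepath (pt (dist x p) (-1)) (pt (dist x p) (min e (excess x y p)))"
  have V_pt: "V t = pt (dist x p) ((1 - t) * (-1) + t * min e (excess x y p))" for t
    by (auto simp: V_def linepath_def vec_eq_iff pt_def algebra_simps)
  have "path G" "path H"
    using g(1) h(1) unfolding path_def G_def H_def excess_def
    by (auto intro!: cont_pt continuous_intros)
  have VH: "pathfinish V = pathstart H"
    using h(3) by (simp add: V_def H_def pathstart_def pathfinish_def linepath_def)
  have h_pos: "dist p z < 2 * l" "dist x z < dist x p + 2 * l" if "z \<in> path_image h" for z
    using bspec[OF h(5) that] l dist_triangle[of x z p] zero_le_dist[of z q] by linarith+
  have "path_image G \<subseteq> cbox (pt 0 (-1)) (pt (dist x y) e)"
  proof -
    have "G t \<in> cbox (pt 0 (-1)) (pt (dist x y) e)" if "t \<in> {0..1}" for t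
      using that g_ex[of "g t"] excess_nonneg[of x y "g t"]
      by (auto simp: G_def box path_image_def)
    then show ?thesis
      by (auto simp: path_image_def)
  qed
  moreover have "path_image (V +++ H) \<subseteq> cbox (pt 0 (-1)) (pt (dist x y) e)"
  proof -
    have "V t \<in> cbox (pt 0 (-1)) (pt (dist x y) e)" if "t \<in> {0..1}" for t
    proof -
      define m where "m = min e (excess x y p)"
      have m: "0 \<le> m" "m \<le> e"
        using e excess_nonneg[of x y p] by (auto simp: m_def)
      then have "0 \<le> t * m" "t * m \<le> m"
        using that by (auto simp: mult_left_le_one_le)
      then have "-1 \<le> (1 - t) * (-1) + t * m" "(1 - t) * (-1) + t * m \<le> e"
        using that m by auto
      then show ?thesis
        using l by (auto simp: V_pt box simp flip: m_def)
    qed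
    moreover have "H t \<in> cbox (pt 0 (-1)) (pt (dist x y) e)" if "t \<in> {0..1}" for t
      using that h_pos(2)[of "h t"] l e excess_nonneg[of x y "h t"]
      by (auto simp: H_def box path_image_def)
    ultimately show ?thesis
      unfolding path_image_join[OF VH] by (auto simp: path_image_def)
  qed
  moreover have "path (V +++ H)"
    using VH \<open>path H\<close> by (simp add: V_def)
  moreover have "pathstart G $ 1 = pt 0 (-1) $ 1" "pathfinish G $ 1 = pt (dist x y) e $ 1"
    using g(3,4) by (simp_all add: G_def pathstart_def pathfinish_def)
  moreover have "pathstart (V +++ H) $ 2 = pt 0 (-1) $ 2" "pathfinish (V +++ H) $ 2 = pt (dist x y) e $ 2"
    using h(4) ex by (simp_all add: V_def) (simp add: H_def pathfinish_def)
  ultimately obtain w where w: "w \<in> path_image G" "w \<in> path_image (V +++ H)"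
    using fashoda[OF \<open>path G\<close>] by blast
  then obtain z where z: "z \<in> path_image g" "w = pt (min (dist x y) (dist x z)) (excess x y z)"
    by (auto simp: G_def path_image_def)
  consider "w \<in> path_image V" | "w \<in> path_image H"
    using w(2) VH by (auto simp: path_image_join)
  then show ?thesis
  proof cases
    case 1
    then obtain t where t: "t \<in> {0..1}" "w = V t"
      by (auto simp: path_image_def)
    have "(1 - t) * (-1) + t * min e (excess x y p) \<le> excess x y p"
    proof -
      have "t * min e (excess x y p) \<le> 1 * min e (excess x y p)"
        using t(1) e excess_nonneg[of x y p] by (intro mult_right_mono) auto
      then show ?thesis
        using t(1) by simp
    qed
    then have "min (dist x y) (dist x z) = dist x p" "excess x y z \<le> excess x y p"
      using t(2) z(2) by (auto simp: V_pt pt_eq)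
    moreover from this have "dist x z = dist x p"
      using l by auto
    ultimately show ?thesis
      using that[of z] z(1) g(2) g_near[of z] d l by auto
  next
    case 2
    then obtain z' where z': "z' \<in> path_image h" "w = pt (dist x z') (min e (excess x y z'))"
      by (auto simp: H_def path_image_def)
    then have eq: "min (dist x y) (dist x z) = dist x z'" "excess x y z = min e (excess x y z')"
      using z(2) by (auto simp: pt_eq)
    \<comment> \<open>\<open>h\<close> stays at levels below \<open>dist x y\<close> and
      \<open>g\<close> stays below excess \<open>e\<close>, so neither minimum is the truncation
      bound.\<close>
    then have xz: "dist x z' = dist x z" "excess x y z' = excess x y z"
      using h_pos(2)[OF z'(1)] l(3) g_ex[OF z(1)] by linarith+
    then have "dist z' y = dist z y"
      by (simp add: excess_def)
    then obtain F where F: "\<And>u. u \<in> M \<Longrightarrow> F u \<in> M"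
        "\<And>u v. u \<in> M \<Longrightarrow> v \<in> M \<Longrightarrow> dist (F u) (F v) = dist u v" "F x = x" "F y = y" "F z' = z"
      using triple_homogeneous[of x y z' z] M z(1) z'(1) g(2) h(2) xz(1) by blast
    have zM: "z' \<in> M"
      using z'(1) h(2) by blast
    have Fp: "dist x (F p) = dist x p" "dist (F p) y = dist p y" "dist z (F p) = dist z' p"
      using F(2)[of x p] F(2)[of p y] F(2)[of z' p] F(3-5) M zM by auto
    have "dist r (F p) \<le> dist r z + dist z' p"
      using dist_triangle[of r "F p" z] Fp(3) by simp
    moreover have "\<bar>dist x z' - dist x p\<bar> \<le> dist p z'"
      using dist_triangle[of x z' p] dist_triangle[of x p z'] by (auto simp: dist_commute)
    \<comment> \<open>\<open>5 * l\<close> consists of \<open>l\<close> for \<open>d\<close>,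
      \<open>2 * l\<close> for the distance from \<open>z'\<close> to \<open>p\<close>, and
      \<open>2 * l\<close> for the difference of their levels.\<close>
    ultimately have "dist r (F p) \<le> \<bar>dist x p - dist x r\<bar> + excess x y r + 5 * l"
      using g_near[OF z(1)] h_pos(1)[OF z'(1)] d(2) xz(1) dist_commute[of p z'] by linarith
    then show ?thesis
      using that[of "F p"] F(1) M(4) Fp by (auto simp: excess_def)
  qed
qed

section \<open>Levels that are not tight\<close>

text \<open>The radius \<open>l\<close> comes before \<open>e\<close>: on balls of one fixed radius
  the excess gets as small as desired. The negation yields, at every scale, bad points next to
  arbitrarily good ones.\<close>

definition tight :: "'a \<Rightarrow> 'a \<Rightarrow> real \<Rightarrow> bool" where
  "tight x y t \<longleftrightarrow> (\<exists>l>0. \<forall>e>0. \<exists>d>0. \<forall>p\<in>M. \<bar>dist x p - t\<bar> < d \<and> excess x y p < d \<longrightarrow>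
     (\<forall>r\<in>M. dist p r \<le> l \<longrightarrow> excess x y r \<le> e))"

text \<open>At each scale \<open>l n\<close>, failure of tightness supplies the pair
  \<open>p, q\<close> with which \<open>improve_between\<close> replaces the current point by a much
  better one at distance of order \<open>l n\<close>. As \<open>l n\<close> is geometric, the points
  converge.\<close>

lemma between_if_not_tight:
  assumes M: "x \<in> M" "y \<in> M" and t: "t < dist x y" and nt: "\<not> tight x y t"
  obtains z where "z \<in> M" "dist x z = t" "excess x y z = 0"
proof -
  \<comment> \<open>The factor \<open>(dist x y - t) / 4\<close> leaves room for
    \<open>dist x p + 2 * l n < dist x y\<close> when \<open>dist x p\<close> is within
    \<open>l n\<close> of \<open>t\<close>.\<close>
  define l where "l = (\<lambda>n::nat. (dist x y - t) / 4 * (1/2) ^ n)"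
  have l: "0 < l n" "l (Suc n) \<le> l n" "l n \<le> (dist x y - t) / 4" for n
    using t mult_left_mono[OF power_le_one[of "1/2::real" n], of "(dist x y - t) / 4"]
    by (auto simp: l_def)
  have "\<exists>e>0. e \<le> l n \<and> (\<forall>d>0. \<exists>p\<in>M. \<bar>dist x p - t\<bar> < d \<and> excess x y p < d \<and>
      (\<exists>r\<in>M. dist p r \<le> l n \<and> e < excess x y r))" for n
  proof -
    have "\<not> (\<forall>e>0. \<exists>d>0. \<forall>p\<in>M. \<bar>dist x p - t\<bar> < d \<and> excess x y p < d \<longrightarrow>
        (\<forall>r\<in>M. dist p r \<le> l n \<longrightarrow> excess x y r \<le> e))"
      using nt l(1)[of n] unfolding tight_def by blast
    then obtain e where e: "e > 0" "\<forall>d>0. \<exists>p\<in>M. \<bar>dist x p - t\<bar> < d \<and> excess x y p < d \<and>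
        (\<exists>r\<in>M. dist p r \<le> l n \<and> e < excess x y r)"
      by (simp add: not_le) blast
    \<comment> \<open>Lowering the threshold keeps bad points bad, and the bound \<open>l n\<close>
      forces the thresholds to tend to zero.\<close>
    show ?thesis
    proof (intro exI[of _ "min e (l n)"] conjI allI impI)
      fix d :: real
      assume "0 < d"
      then obtain p r where "p \<in> M" "\<bar>dist x p - t\<bar> < d" "excess x y p < d" "r \<in> M"
          "dist p r \<le> l n" "e < excess x y r"
        using e(2) by blast
      then show "\<exists>p\<in>M. \<bar>dist x p - t\<bar> < d \<and> excess x y p < d \<and>
          (\<exists>r\<in>M. dist p r \<le> l n \<and> min e (l n) < excess x y r)"
        by (intro bexI[of _ p] conjI bexI[of _ r]) auto
    qed (use e(1) l(1)[of n] in auto)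
  qed
  then obtain e where e: "\<And>n. 0 < e n" "\<And>n. e n \<le> l n"
      "\<And>n d. 0 < d \<Longrightarrow> \<exists>p\<in>M. \<bar>dist x p - t\<bar> < d \<and> excess x y p < d \<and>
        (\<exists>r\<in>M. dist p r \<le> l n \<and> e n < excess x y r)"
    by metis
  have "\<exists>s. \<forall>n. (s n \<in> M \<and> \<bar>dist x (s n) - t\<bar> < e n \<and> excess x y (s n) < e n) \<and>
      dist (s n) (s (Suc n)) \<le> 8 * l n"
  proof (rule dependent_nat_choice)
    show "\<exists>r. r \<in> M \<and> \<bar>dist x r - t\<bar> < e 0 \<and> excess x y r < e 0"
      using e(3)[OF e(1)[of 0]] by blast
    fix r n
    assume r: "r \<in> M \<and> \<bar>dist x r - t\<bar> < e n \<and> excess x y r < e n"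
    \<comment> \<open>\<open>p\<close> already meets the threshold of stage \<open>Suc n\<close>,
      while its neighbour \<open>q\<close> violates the threshold of stage \<open>n\<close>, which
      \<open>r\<close> meets.\<close>
    obtain p q where pq: "p \<in> M" "\<bar>dist x p - t\<bar> < e (Suc n)" "excess x y p < e (Suc n)"
        "q \<in> M" "dist p q \<le> l n" "e n < excess x y q"
      using e(3)[OF e(1)[of "Suc n"], of n] by blast
    have el: "e n \<le> l n" "e (Suc n) \<le> l n"
      using e(2)[of n] e(2)[of "Suc n"] l(2)[of n] by linarith+
    then have "dist x p + 2 * l n < dist x y"
      using pq(2) l(3)[of n] t by (simp add: field_simps)
    then obtain p' where p': "p' \<in> M" "dist x p' = dist x p" "excess x y p' \<le> excess x y p"
        "dist r p' \<le> \<bar>dist x p - dist x r\<bar> + excess x y r + 5 * l n"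
      using improve_between[of x y r p q "l n" "e n"] M r pq l(1) by blast
    \<comment> \<open>\<open>2 * l n\<close> for the levels of \<open>p\<close> and
      \<open>r\<close>, both within \<open>l n\<close> of \<open>t\<close>, and \<open>l n\<close>
      for the excess of \<open>r\<close>, on top of \<open>5 * l n\<close>.\<close>
    have "dist r p' \<le> 8 * l n"
      using p'(4) r pq(2) el by linarith
    then show "\<exists>p'. (p' \<in> M \<and> \<bar>dist x p' - t\<bar> < e (Suc n) \<and> excess x y p' < e (Suc n)) \<and>
        dist r p' \<le> 8 * l n"
      using p'(1-3) pq(2,3) by force
  qed
  then obtain s where s: "\<And>n. s n \<in> M" "\<And>n. \<bar>dist x (s n) - t\<bar> < e n"
      "\<And>n. excess x y (s n) < e n" "\<And>n. dist (s n) (s (Suc n)) \<le> 8 * l n"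
    by blast
  have "Cauchy s"
    by (rule Cauchy_if_dist_Suc_le_geometric[of s "8 * ((dist x y - t) / 4)"])
      (use s(4) in \<open>simp only: l_def mult.assoc\<close>)
  then obtain z where z: "z \<in> M" "s \<longlonglongrightarrow> z"
    using complete s(1) unfolding complete_def by blast
  have "(\<lambda>n. (dist x y - t) / 4 * (1/2) ^ n) \<longlonglongrightarrow> (dist x y - t) / 4 * 0"
    by (intro tendsto_mult tendsto_const LIMSEQ_power_zero) simp
  then have l0: "l \<longlonglongrightarrow> 0"
    by (simp add: l_def)
  have lim: "(\<lambda>n. \<bar>dist x (s n) - t\<bar>) \<longlonglongrightarrow> \<bar>dist x z - t\<bar>"
      "(\<lambda>n. excess x y (s n)) \<longlonglongrightarrow> excess x y z"
    unfolding excess_def by (intro tendsto_intros z(2))+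
  have "\<bar>dist x z - t\<bar> \<le> 0" "excess x y z \<le> 0"
    using LIMSEQ_le[OF lim(1) l0] LIMSEQ_le[OF lim(2) l0] s(2,3) e(2) by (meson less_le_trans less_imp_le)+
  then show ?thesis
    using that z(1) excess_nonneg[of x y z] by force
qed

section \<open>Consequences of tightness at every level\<close>

text \<open>Homogeneity carries \<open>x', y'\<close> to \<open>x, y\<close>, so the constants of
  tightness depend only on the distance of the pair.\<close>

lemma tight_isometric:
  assumes "tight x y t" "x \<in> M" "y \<in> M"
  obtains l where "0 < l" "\<And>e. 0 < e \<Longrightarrow> \<exists>d>0. \<forall>x'\<in>M. \<forall>y'\<in>M. \<forall>p\<in>M.
    dist x' y' = dist x y \<and> \<bar>dist x' p - t\<bar> < d \<and> excess x' y' p < d \<longrightarrow>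
      (\<forall>r\<in>M. dist p r \<le> l \<longrightarrow> excess x' y' r \<le> e)"
proof -
  obtain l where l: "l > 0" "\<forall>e>0. \<exists>d>0. \<forall>p\<in>M. \<bar>dist x p - t\<bar> < d \<and> excess x y p < d \<longrightarrow>
      (\<forall>r\<in>M. dist p r \<le> l \<longrightarrow> excess x y r \<le> e)"
    using assms(1) unfolding tight_def by blast
  show ?thesis
  proof (rule that[OF l(1)])
    fix e :: real
    assume "0 < e"
    then obtain d where d: "d > 0" "\<forall>p\<in>M. \<bar>dist x p - t\<bar> < d \<and> excess x y p < d \<longrightarrow>
        (\<forall>r\<in>M. dist p r \<le> l \<longrightarrow> excess x y r \<le> e)"
      using l(2) by blast
    have "excess x' y' r \<le> e"
      if M': "x' \<in> M" "y' \<in> M" "p \<in> M" "r \<in> M" and same: "dist x' y' = dist x y"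
        and near: "\<bar>dist x' p - t\<bar> < d" "excess x' y' p < d" "dist p r \<le> l" for x' y' p r
    proof -
      obtain F where F: "\<And>u. u \<in> M \<Longrightarrow> F u \<in> M"
          "\<And>u v. u \<in> M \<Longrightarrow> v \<in> M \<Longrightarrow> dist (F u) (F v) = dist u v" "F x' = x" "F y' = y"
        using pair_homogeneous[OF M'(1,2) assms(2,3) same] by blast
      have pos: "dist x (F u) = dist x' u" if "u \<in> M" for u
        using F(2)[OF M'(1) that] F(3) by simp
      have ex: "excess x y (F u) = excess x' y' u" if "u \<in> M" for u
        using pos[OF that] F(2)[OF that M'(2)] F(4) same by (simp add: excess_def)
      have "excess x y (F r) \<le> e"
        using bspec[OF d(2) F(1)[OF M'(3)]] F(1)[OF M'(4)] F(2)[OF M'(3,4)] near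
          pos[OF M'(3)] ex[OF M'(3)] by simp
      then show ?thesis
        using ex[OF M'(4)] by simp
    qed
    then show "\<exists>d>0. \<forall>x'\<in>M. \<forall>y'\<in>M. \<forall>p\<in>M.
        dist x' y' = dist x y \<and> \<bar>dist x' p - t\<bar> < d \<and> excess x' y' p < d \<longrightarrow>
          (\<forall>r\<in>M. dist p r \<le> l \<longrightarrow> excess x' y' r \<le> e)"
      using d(1) by blast
  qed
qed

text \<open>Compactness of the interval of levels away from both ends reduces the choice of
  \<open>l\<close>, and then of \<open>d\<close>, to finitely many levels.\<close>

lemma tight_uniform:
  assumes M: "x \<in> M" "y \<in> M"
    and tight: "\<forall>t\<in>{0<..<dist x y}. tight x y t" and c: "0 < c"
  obtains l where "0 < l"
    "\<And>e. 0 < e \<Longrightarrow> \<exists>d>0. \<forall>p\<in>M. c \<le> dist x p \<and> c \<le> dist p y \<and> excess x y p < d \<longrightarrow>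
      (\<forall>r\<in>M. dist p r \<le> l \<longrightarrow> excess x y r \<le> e)"
proof -
  \<comment> \<open>The margin is \<open>c / 2\<close> because \<open>c \<le> dist p y\<close>
    bounds \<open>dist x p\<close> only by \<open>dist x y - c\<close> plus the excess of
    \<open>p\<close>.\<close>
  define I where "I = {c / 2..dist x y - c / 2}"
  have "\<forall>t\<in>I. tight x y t"
    using tight c by (auto simp: I_def)
  then obtain l where l: "\<And>t. t \<in> I \<Longrightarrow> 0 < l t"
      "\<And>t e. t \<in> I \<Longrightarrow> 0 < e \<Longrightarrow> \<exists>d>0. \<forall>p\<in>M. \<bar>dist x p - t\<bar> < d \<and> excess x y p < d \<longrightarrow>
        (\<forall>r\<in>M. dist p r \<le> l t \<longrightarrow> excess x y r \<le> e)"
    unfolding tight_def by metis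
  have "I \<subseteq> (\<Union>t\<in>I. ball t (l t / 4))"
    using l(1) by force
  then obtain T where T: "T \<subseteq> I" "finite T" "I \<subseteq> (\<Union>t\<in>T. ball t (l t / 4))"
    using compactE_image[of I I "\<lambda>t. ball t (l t / 4)"] by (auto simp: I_def)
  \<comment> \<open>The \<open>1\<close> provides for an empty \<open>T\<close>, which occurs when
    \<open>I\<close> is empty.\<close>
  define m where "m = Min (insert 1 ((\<lambda>t. l t / 2) ` T))"
  have m: "0 < m" "\<And>t. t \<in> T \<Longrightarrow> m \<le> l t / 2"
  proof -
    show "0 < m"
      using T(1,2) l(1) by (auto simp: m_def subset_iff)
    show "m \<le> l t / 2" if "t \<in> T" for t
      using T(2) that unfolding m_def by (intro Min_le) auto
  qed
  show ?thesis
  proof (rule that[OF m(1)])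
    fix e :: real
    assume "0 < e"
    then obtain d where d: "\<And>t. t \<in> I \<Longrightarrow> 0 < d t"
        "\<And>t p r. t \<in> I \<Longrightarrow> p \<in> M \<Longrightarrow> \<bar>dist x p - t\<bar> < d t \<Longrightarrow> excess x y p < d t \<Longrightarrow> r \<in> M \<Longrightarrow>
          dist p r \<le> l t \<Longrightarrow> excess x y r \<le> e"
      using l(2)[OF _ \<open>0 < e\<close>] by metis
    define k where "k = Min (insert (c / 2) ((\<lambda>t. min (d t / 2) (l t / 8)) ` T))"
    have k: "0 < k" "k \<le> c / 2" "\<And>t. t \<in> T \<Longrightarrow> k \<le> d t / 2" "\<And>t. t \<in> T \<Longrightarrow> k \<le> l t / 8"
    proof -
      show "0 < k"
        using T(1,2) l(1) d(1) c by (auto simp: k_def subset_iff)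
      show "k \<le> c / 2"
        using T(2) unfolding k_def by (intro Min_le) auto
      have "k \<le> min (d t / 2) (l t / 8)" if "t \<in> T" for t
        using T(2) that unfolding k_def by (intro Min_le) auto
      then show "\<And>t. t \<in> T \<Longrightarrow> k \<le> d t / 2" "\<And>t. t \<in> T \<Longrightarrow> k \<le> l t / 8"
        by auto
    qed
    have "excess x y r \<le> e"
      if p: "p \<in> M" "c \<le> dist x p" "c \<le> dist p y" "excess x y p < k" and r: "r \<in> M" "dist p r \<le> m" for p r
    proof -
      have "dist x p \<in> I"
        using p k(2) c by (auto simp: I_def excess_def)
      then obtain t where t: "t \<in> T" "\<bar>dist x p - t\<bar> < l t / 4"
        using T(3) by (fastforce simp: dist_real_def abs_minus_commute)
      then have tI: "t \<in> I" "0 \<le> t" "t \<le> dist x y"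
        using T(1) c by (auto simp: I_def)
      \<comment> \<open>The cover controls the level of \<open>p\<close> by \<open>l t\<close>, not
        by \<open>d t\<close>, which depends on \<open>e\<close>. Hence tightness is applied at a
        point \<open>q\<close> of level exactly \<open>t\<close>.\<close>
      obtain q where q: "q \<in> M" "dist x q = t" "excess x y q < excess x y p + k"
          "dist p q < \<bar>dist x p - t\<bar> + excess x y p + k"
        using slide_between[OF M p(1) k(1) tI(2,3)] by blast
      \<comment> \<open>\<open>l t / 4\<close> for the change of level, at most
        \<open>l t / 4\<close> for \<open>2 * k\<close>, and \<open>l t / 2\<close> for
        \<open>m\<close>.\<close>
      have "dist q r \<le> l t"
        using dist_triangle[of q r p] dist_commute[of p q] q(4) r(2) m(2)[OF t(1)] k(4)[OF t(1)] p(4) t(2)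
        by linarith
      moreover have "excess x y q < d t"
        using q(3) p(4) k(3)[OF t(1)] by linarith
      ultimately show ?thesis
        using d(2)[OF tI(1) q(1) _ _ r(1)] q(2) d(1)[OF tI(1)] by simp
    qed
    then show "\<exists>d>0. \<forall>p\<in>M. c \<le> dist x p \<and> c \<le> dist p y \<and> excess x y p < d \<longrightarrow>
        (\<forall>r\<in>M. dist p r \<le> m \<longrightarrow> excess x y r \<le> e)"
      using k(1) by blast
  qed
qed

text \<open>The inequalities with \<open>c\<close> keep almost shortest paths from \<open>p\<close>
  to \<open>w\<close> away from \<open>x\<close> and \<open>y\<close>. Along such a path
  \<open>tight_uniform\<close> is applied in steps, whose number is bounded in terms of
  \<open>L\<close>.\<close>

lemma tight_propagate:
  assumes M: "x \<in> M" "y \<in> M"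
    and tight: "\<forall>t\<in>{0<..<dist x y}. tight x y t" and "0 < c" "0 < e"
  shows "\<exists>d>0. \<forall>p\<in>M. \<forall>w\<in>M. excess x y p < d \<and> dist p w \<le> L \<and>
    dist p w < dist p x + dist x w - c \<and> dist p w < dist p y + dist y w - c \<longrightarrow> excess x y w \<le> e"
proof -
  have "0 < c / 4"
    using \<open>0 < c\<close> by simp
  then obtain l where l: "0 < l"
    "\<And>e. 0 < e \<Longrightarrow> \<exists>d>0. \<forall>p\<in>M. c / 4 \<le> dist x p \<and> c / 4 \<le> dist p y \<and> excess x y p < d \<longrightarrow>
      (\<forall>r\<in>M. dist p r \<le> l \<longrightarrow> excess x y r \<le> e)"
    using tight_uniform[OF M tight, of "c / 4"] by blast
  txt \<open>Each step costs an arbitrarily small part of the margin \<open>b\<close>, which must stay above \<open>c / 2\<close>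
    to keep the intermediate points away from \<open>x\<close> and \<open>y\<close>.\<close>
  have steps: "\<exists>d>0. \<forall>p\<in>M. \<forall>w\<in>M. excess x y p < d \<and> dist p w \<le> of_nat n * (l / 2) \<and>
      dist p w < dist p x + dist x w - b \<and> dist p w < dist p y + dist y w - b \<longrightarrow> excess x y w \<le> e"
    if "c / 2 < b" "0 < e" for n b e
    using that
  proof (induction n arbitrary: b e)
    case 0
    then show ?case
      by (intro exI[of _ e]) auto
  next
    case (Suc n)
    define k where "k = min (l / 2) (b - c / 2) / 2"
    have k: "0 < k" "k \<le> l / 4" "c / 2 < b - k"
      using l(1) Suc.prems(1) by (auto simp: k_def min_def field_simps)
    obtain d where d: "d > 0" "\<And>p r. p \<in> M \<Longrightarrow> c / 4 \<le> dist x p \<Longrightarrow> c / 4 \<le> dist p y \<Longrightarrow>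
        excess x y p < d \<Longrightarrow> r \<in> M \<Longrightarrow> dist p r \<le> l \<Longrightarrow> excess x y r \<le> e"
      using l(2)[OF Suc.prems(2)] by blast
    obtain d' where d': "d' > 0" "\<And>p w. p \<in> M \<Longrightarrow> w \<in> M \<Longrightarrow> excess x y p < d' \<Longrightarrow>
        dist p w \<le> of_nat n * (l / 2) \<Longrightarrow> dist p w < dist p x + dist x w - (b - k) \<Longrightarrow>
        dist p w < dist p y + dist y w - (b - k) \<Longrightarrow> excess x y w \<le> d / 2"
      using Suc.IH[of "b - k" "d / 2"] k(3) d(1) by auto
    have "excess x y w \<le> e"
      if p: "p \<in> M" "w \<in> M" "excess x y p < d'" "dist p w \<le> of_nat (Suc n) * (l / 2)"
        "dist p w < dist p x + dist x w - b" "dist p w < dist p y + dist y w - b" for p w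
    proof -
      \<comment> \<open>The last step is split off: \<open>z\<close> is within reach of
        \<open>n\<close> steps from \<open>p\<close>, and less than \<open>l / 2 + k\<close> from
        \<open>w\<close>.\<close>
      define u where "u = min (dist p w) (of_nat n * (l / 2))"
      have u: "0 \<le> u" "u \<le> dist p w" "u \<le> of_nat n * (l / 2)" "dist p w - u \<le> l / 2"
        using l(1) p(4) by (auto simp: u_def min_def algebra_simps)
      obtain z where z: "z \<in> M" "dist p z = u" "dist p z + dist z w < dist p w + k"
        using almost_geodesic_level[of p w k p u] p(1,2) k(1) u by auto
      have zx: "dist p z < dist p x + dist x z - (b - k)"
        using z(3) p(5) dist_triangle[of x w z] by linarith
      have zy: "dist p z < dist p y + dist y z - (b - k)"
        using z(3) p(6) dist_triangle[of y w z] by linarith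
      have "excess x y z \<le> d / 2"
        using d'(2)[OF p(1) z(1) p(3) _ zx zy] z(2) u(3) by simp
      \<comment> \<open>By the triangle inequality the remaining margin, which exceeds
        \<open>c / 2\<close>, is less than twice the distance from \<open>z\<close> to
        \<open>x\<close> or to \<open>y\<close>.\<close>
      moreover have "c / 4 \<le> dist x z" "c / 4 \<le> dist z y"
        using zx zy k(3) dist_triangle[of p x z] dist_triangle[of p y z]
          dist_commute[of x z] dist_commute[of y z] by linarith+
      moreover have "dist z w \<le> l"
        using z(2,3) u(4) k(2) l(1) by linarith
      ultimately show ?thesis
        using d(2)[OF z(1) _ _ _ p(2)] d(1) by simp
    qed
    then show ?case
      using d'(1) by blast
  qed
  obtain n :: nat where "L / (l / 2) \<le> of_nat n"
    using real_arch_simple by blast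
  then have n: "L \<le> of_nat n * (l / 2)"
    using l(1) by (simp add: field_simps)
  obtain d where d: "d > 0" "\<forall>p\<in>M. \<forall>w\<in>M. excess x y p < d \<and> dist p w \<le> of_nat n * (l / 2) \<and>
      dist p w < dist p x + dist x w - c \<and> dist p w < dist p y + dist y w - c \<longrightarrow> excess x y w \<le> e"
    using steps[of c e n] \<open>0 < c\<close> \<open>0 < e\<close> by auto
  then show ?thesis
    using n by (meson order_trans)
qed

text \<open>Otherwise \<open>tight_propagate\<close> would push the excess of \<open>w\<close> down
  to half its value. So \<open>x\<close> or \<open>y\<close> lies almost between \<open>p\<close>
  and \<open>w\<close>.\<close>

lemma tight_far:
  assumes M: "x \<in> M" "y \<in> M" "w \<in> M"
    and tight: "\<forall>t\<in>{0<..<dist x y}. tight x y t"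
    and w: "0 < excess x y w" and c: "0 < c"
  obtains d where "0 < d" "\<And>p. p \<in> M \<Longrightarrow> excess x y p < d \<Longrightarrow>
    dist p x + dist x w - c \<le> dist p w \<or> dist p y + dist y w - c \<le> dist p w"
proof -
  obtain d where d: "0 < d" "\<And>p w'. p \<in> M \<Longrightarrow> w' \<in> M \<Longrightarrow> excess x y p < d \<Longrightarrow>
      dist p w' \<le> dist x y + 1 + dist x w \<Longrightarrow> dist p w' < dist p x + dist x w' - c \<Longrightarrow>
      dist p w' < dist p y + dist y w' - c \<Longrightarrow> excess x y w' \<le> excess x y w / 2"
    using tight_propagate[OF M(1,2) tight c, of "excess x y w / 2" "dist x y + 1 + dist x w"] w
    by auto
  \<comment> \<open>Excess below 1 bounds \<open>dist p x\<close>, and hence \<open>dist p w\<close>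
    by the constant taken for \<open>L\<close>.\<close>
  show ?thesis
  proof (rule that[of "min d 1"])
    fix p
    assume p: "p \<in> M" "excess x y p < min d 1"
    have "dist p x \<le> dist x y + 1"
      using p(2) zero_le_dist[of p y] unfolding excess_def dist_commute[of p x] by linarith
    then have "dist p w \<le> dist x y + 1 + dist x w"
      using dist_triangle[of p w x] by linarith
    then show "dist p x + dist x w - c \<le> dist p w \<or> dist p y + dist y w - c \<le> dist p w"
      using d(2)[OF p(1) M(3)] p(2) w by force
  qed (use d(1) in simp)
qed

lemma not_all_tight:
  assumes M: "x \<in> M" "y \<in> M" "x \<noteq> y"
    and no_between: "\<And>z. z \<in> M \<Longrightarrow> excess x y z = 0 \<Longrightarrow> z = x \<or> z = y"
    and tight: "\<forall>t\<in>{0<..<dist x y}. tight x y t"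
  shows False
proof -
  define D where "D = dist x y"
  have D: "0 < D"
    using M(3) by (simp add: D_def)
  have pos: "0 < excess x y z" if "z \<in> M" "0 < dist x z" "dist x z < D" for z
  proof -
    have "z \<noteq> x \<and> z \<noteq> y"
      using that(2,3) by (auto simp: D_def)
    then show ?thesis
      using no_between[OF that(1)] excess_nonneg[of x y z] by fastforce
  qed
  have far: "\<exists>d>0. \<forall>p\<in>M. excess x y p < d \<longrightarrow>
      dist p x + dist x w - c \<le> dist p w \<or> dist p y + dist y w - c \<le> dist p w"
    if "w \<in> M" "0 < dist x w" "dist x w < D" "0 < c" for w c
    by (rule tight_far[OF M(1,2) that(1) tight pos[OF that(1-3)] that(4)]) blast
  obtain q where q: "q \<in> M" "dist x q = D / 2"
    using almost_between[OF M(1,2), of 1 "D / 2"] D by (auto simp: D_def)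
  define k where "k = min (excess x y q) D / 4"
  have k: "0 < k" "4 * k \<le> D" "4 * k \<le> excess x y q"
    using pos[OF q(1)] q(2) D by (auto simp: k_def)
  have "tight x y (D / 2)"
    using tight D by (simp add: D_def)
  \<comment> \<open>This will be applied to the pair \<open>q, p'\<close> at distance
    \<open>D\<close>, with \<open>x\<close> almost at its middle.\<close>
  then obtain l where l: "0 < l" "\<And>e. 0 < e \<Longrightarrow> \<exists>d>0. \<forall>x'\<in>M. \<forall>y'\<in>M. \<forall>p\<in>M.
      dist x' y' = D \<and> \<bar>dist x' p - D / 2\<bar> < d \<and> excess x' y' p < d \<longrightarrow>
        (\<forall>r\<in>M. dist p r \<le> l \<longrightarrow> excess x' y' r \<le> e)"
    using tight_isometric[OF _ M(1,2)] unfolding D_def by blast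
  define s where "s = min l (D / 4)"
  have s: "0 < s" "s \<le> l" "4 * s \<le> D"
    using l(1) D by (auto simp: s_def)
  \<comment> \<open>Tightness gives \<open>v\<close> small excess over \<open>q, p'\<close>, and
    \<open>tight_far\<close> puts \<open>v\<close> at distance about \<open>D / 2 + s\<close> from
    \<open>p'\<close>; this leaves \<open>D / 2 - s\<close> for \<open>dist q v\<close>.\<close>
  have near_q: "dist q v \<le> D / 2 - s" if v: "v \<in> M" "dist x v = s" for v
  proof (rule field_le_epsilon)
    fix e :: real
    assume "0 < e"
    then obtain d where d: "0 < d" "\<forall>x'\<in>M. \<forall>y'\<in>M. \<forall>p\<in>M.
        dist x' y' = D \<and> \<bar>dist x' p - D / 2\<bar> < d \<and> excess x' y' p < d \<longrightarrow>
          (\<forall>r\<in>M. dist p r \<le> l \<longrightarrow> excess x' y' r \<le> e / 4)"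
      using l(2)[of "e / 4"] by auto
    define c where "c = min k (min (d / 2) (e / 4))"
    have c: "0 < c" "c \<le> k" "c \<le> d / 2" "c \<le> e / 4"
      using k(1) d(1) \<open>0 < e\<close> by (auto simp: c_def)
    obtain dq where dq: "0 < dq" "\<forall>p\<in>M. excess x y p < dq \<longrightarrow>
        dist p x + dist x q - c \<le> dist p q \<or> dist p y + dist y q - c \<le> dist p q"
      using far[OF q(1) _ _ c(1)] q(2) D by auto
    obtain dv where dv: "0 < dv" "\<forall>p\<in>M. excess x y p < dv \<longrightarrow>
        dist p x + dist x v - c \<le> dist p v \<or> dist p y + dist y v - c \<le> dist p v"
      using far[OF v(1) _ _ c(1)] v(2) s D by auto
    \<comment> \<open>The surplus \<open>k\<close> in the level pays for the error \<open>c\<close>: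
      \<open>p\<close> is at least \<open>D\<close> away from \<open>q\<close>, so a point
      \<open>p'\<close> at distance exactly \<open>D\<close> can be found on the way from
      \<open>x\<close> to \<open>p\<close>.\<close>
    obtain p where p: "p \<in> M" "dist x p = D / 2 + k" "excess x y p < min dq (dv / 2)"
      using almost_between[OF M(1,2), of "min dq (dv / 2)" "D / 2 + k"] dq(1) dv(1) D k
      by (auto simp: D_def)
    \<comment> \<open>In the alternative at \<open>y\<close>, the excess of \<open>q\<close>, at
      least \<open>4 * k\<close>, outweighs the loss of \<open>k\<close> in
      \<open>dist p y\<close>.\<close>
    have "D + k - c \<le> dist q p"
      using bspec[OF dq(2) p(1)] p(2,3) q(2) k(1,3) dist_triangle[of x y p]
      by (auto simp: excess_def D_def dist_commute)
    then obtain p' where p': "p' \<in> M" "dist q p' = D"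
        "dist x p' + dist p' p < dist x p + min c (dv / 2)"
      using almost_geodesic_level[of x p "min c (dv / 2)" q D] M(1) p(1) q(2) c dv(1) D
      by (auto simp: dist_commute)
    have "excess x y p' < dv"
      using p(3) p'(3) dist_triangle[of p' y p] unfolding excess_def by linarith
    then have "dist p' x + dist x v - c \<le> dist p' v \<or> dist p' y + dist y v - c \<le> dist p' v"
      using dv(2) p'(1) by blast
    moreover have xp': "D / 2 \<le> dist x p'" "dist x p' < D / 2 + 2 * c"
    proof -
      show "D / 2 \<le> dist x p'"
        using dist_triangle[of q p' x] p'(2) q(2) by (simp add: dist_commute)
      show "dist x p' < D / 2 + 2 * c"
        using dist_triangle[of q p p'] p'(2,3) \<open>D + k - c \<le> dist q p\<close> p(2) by simp
    qed
    moreover have "D - dist x p' \<le> dist p' y" "D - s \<le> dist y v"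
      using dist_triangle[of x y p'] dist_triangle[of x y v] v(2) by (simp_all add: D_def dist_commute)
    ultimately have "D / 2 + s - 3 * c \<le> dist v p'"
      using v(2) s(3) D c(1) dist_commute[of p' x] dist_commute[of v p'] by linarith
    moreover have "dist q v + dist v p' \<le> D + e / 4"
    proof -
      have "excess q p' x < d"
        using xp'(2) q(2) p'(2) c(3) by (simp add: excess_def dist_commute)
      then have "excess q p' v \<le> e / 4"
        using d q p' M(1) v s(2) by (auto simp: dist_commute)
      then show ?thesis
        using p'(2) by (simp add: excess_def)
    qed
    ultimately show "dist q v \<le> D / 2 - s + e"
      using c(4) by linarith
  qed
  obtain w where w: "w \<in> M" "dist x w = s"
    using almost_between[OF M(1,2), of 1 s] s D by (auto simp: D_def)
  obtain d where d: "0 < d" "\<forall>p\<in>M. excess x y p < d \<longrightarrow>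
      dist p x + dist x w - s \<le> dist p w \<or> dist p y + dist y w - s \<le> dist p w"
    using far[OF w(1) _ _ s(1)] w(2) s D by auto
  obtain p where p: "p \<in> M" "dist x p = D / 2" "excess x y p < d"
    using almost_between[OF M(1,2) d(1), of "D / 2"] D by (auto simp: D_def)
  have "D / 2 \<le> dist p w"
    using mp[OF bspec[OF d(2) p(1)] p(3)] p(2) w(2) s dist_triangle[of x y p] dist_triangle[of x y w]
      dist_commute[of p x] dist_commute[of y w] unfolding D_def by linarith
  \<comment> \<open>\<open>near_q\<close> covers all points at distance \<open>s\<close> from
    \<open>x\<close>, so it applies to \<open>F w\<close> wherever \<open>F\<close> sends
    \<open>w\<close>.\<close>
  moreover obtain F where F: "\<And>u. u \<in> M \<Longrightarrow> F u \<in> M"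
      "\<And>u v. u \<in> M \<Longrightarrow> v \<in> M \<Longrightarrow> dist (F u) (F v) = dist u v" "F x = x" "F p = q"
    using pair_homogeneous[OF M(1) p(1) M(1) q(1)] p(2) q(2) by auto
  have "dist p w \<le> D / 2 - s"
    using near_q[OF F(1)[OF w(1)]] F(2)[OF M(1) w(1)] F(2)[OF p(1) w(1)] F(3,4) w(2) by simp
  ultimately show False
    using s(1) by simp
qed

section \<open>Geodesics from points in between\<close>

lemma between_exists:
  assumes "x \<in> M" "y \<in> M" "x \<noteq> y"
  obtains z where "z \<in> M" "z \<noteq> x" "z \<noteq> y" "dist x z + dist z y = dist x y"
proof (cases "\<exists>z\<in>M. excess x y z = 0 \<and> z \<noteq> x \<and> z \<noteq> y")
  case True
  then show ?thesis
    using that by (auto simp: excess_def)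
next
  case False
  then obtain t where t: "0 < t" "t < dist x y" "\<not> tight x y t"
    using not_all_tight[OF assms] by (auto simp: Ball_def)
  then obtain z where "z \<in> M" "dist x z = t" "excess x y z = 0"
    using between_if_not_tight assms by metis
  then show ?thesis
    using False t by auto
qed

text \<open>In a maximal subset of \<open>M\<close> on which \<open>dist x\<close> is an isometry
  into \<open>{0..dist x y}\<close>, a gap between levels could be filled by
  \<open>between_exists\<close>. So \<open>dist x\<close> is onto, and its inverse is the
  geodesic.\<close>

lemma geodesic_space: "geodesic_space M"
  unfolding geodesic_space_def
proof (intro ballI)
  fix x y
  assume M: "x \<in> M" "y \<in> M"
  define \<C> where "\<C> = {A. A \<subseteq> M \<and> x \<in> A \<and> y \<in> A \<and> (\<forall>u\<in>A. dist x u \<le> dist x y) \<and>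
    (\<forall>u\<in>A. \<forall>v\<in>A. dist u v = \<bar>dist x u - dist x v\<bar>)}"
  have "\<exists>A\<in>\<C>. \<forall>B\<in>\<C>. A \<subseteq> B \<longrightarrow> B = A"
  proof (rule subset_Zorn_nonempty)
    have "{x, y} \<in> \<C>"
      using M by (auto simp: \<C>_def dist_commute)
    then show "\<C> \<noteq> {}"
      by blast
    fix \<A>
    assume \<A>: "\<A> \<noteq> {}" "subset.chain \<C> \<A>"
    then have "\<A> \<subseteq> \<C>" and tot: "\<And>A B. A \<in> \<A> \<Longrightarrow> B \<in> \<A> \<Longrightarrow> A \<subseteq> B \<or> B \<subseteq> A"
      by (auto simp: subset_chain_def)
    have "dist u v = \<bar>dist x u - dist x v\<bar>" if uv: "u \<in> \<Union>\<A>" "v \<in> \<Union>\<A>" for u v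
    proof -
      obtain A where "A \<in> \<A>" "u \<in> A" "v \<in> A"
        using uv tot by blast
      then show ?thesis
        using \<open>\<A> \<subseteq> \<C>\<close> unfolding \<C>_def by blast
    qed
    then show "\<Union>\<A> \<in> \<C>"
      using \<open>\<A> \<noteq> {}\<close> \<open>\<A> \<subseteq> \<C>\<close> unfolding \<C>_def by blast
  qed
  then obtain A where A: "A \<in> \<C>" and maximal: "\<And>B. B \<in> \<C> \<Longrightarrow> A \<subseteq> B \<Longrightarrow> B = A"
    by blast
  have AM: "A \<subseteq> M" "x \<in> A" "y \<in> A" and le: "\<And>u. u \<in> A \<Longrightarrow> dist x u \<le> dist x y"
    and iso: "\<And>u v. u \<in> A \<Longrightarrow> v \<in> A \<Longrightarrow> dist u v = \<bar>dist x u - dist x v\<bar>"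
    using A unfolding \<C>_def by blast+
  \<comment> \<open>The defining equations pass to limits and completeness keeps the closure inside
    \<open>M\<close>, so maximality makes \<open>A\<close> closed.\<close>
  have "closure A \<in> \<C>"
  proof -
    have "closure A \<subseteq> M"
      using AM(1) complete by (simp add: closure_minimal complete_imp_closed)
    moreover have "dist x u \<le> dist x y" if "u \<in> closure A" for u
      by (rule continuous_le_on_closure[OF _ that, of "dist x"])
        (auto intro!: continuous_intros le)
    moreover have "dist u v = \<bar>dist x u - dist x v\<bar>" if u: "u \<in> closure A" and v: "v \<in> closure A" for u v
    proof -
      have 1: "dist u v - \<bar>dist x u - dist x v\<bar> = 0" if "v \<in> A" for v
        by (rule continuous_constant_on_closure[OF _ _ u, of "\<lambda>u. dist u v - \<bar>dist x u - dist x v\<bar>"])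
          (auto intro!: continuous_intros simp: iso that)
      have "dist u v - \<bar>dist x u - dist x v\<bar> = 0"
        by (rule continuous_constant_on_closure[OF _ _ v, of "\<lambda>v. dist u v - \<bar>dist x u - dist x v\<bar>"])
          (auto intro!: continuous_intros simp: 1)
      then show ?thesis
        by simp
    qed
    ultimately show ?thesis
      using AM(2,3) closure_subset[of A] unfolding \<C>_def by blast
  qed
  then have "closed A"
    using maximal[of "closure A"] closure_subset[of A] closure_eq[of A] by simp
  then have "complete A"
    using AM(1) complete complete_Int_closed[of M A] by (simp add: Int_absorb1)
  \<comment> \<open>As \<open>dist x\<close> preserves distances on \<open>A\<close>, completeness
    of \<open>A\<close> passes to its image.\<close>
  have closed: "closed (dist x ` A)"
  proof (rule complete_imp_closed, unfold complete_def, intro allI impI, elim conjE)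
    fix f
    assume f: "\<forall>n. f n \<in> dist x ` A" and "Cauchy f"
    from f have "\<forall>n. \<exists>u. u \<in> A \<and> f n = dist x u"
      by blast
    then obtain a where a: "\<And>n. a n \<in> A" "\<And>n. f n = dist x (a n)"
      by metis
    have "dist (f m) (f n) = dist (a m) (a n)" for m n
      using iso[OF a(1,1), of m n] by (simp add: a(2) dist_real_def)
    then have "Cauchy a"
      using \<open>Cauchy f\<close> by (simp add: Cauchy_def)
    then obtain b where "b \<in> A" "a \<longlonglongrightarrow> b"
      using \<open>complete A\<close> a(1) unfolding complete_def by blast
    then have "f \<longlonglongrightarrow> dist x b"
      unfolding a(2)[abs_def] by (intro tendsto_intros)
    then show "\<exists>l\<in>dist x ` A. f \<longlonglongrightarrow> l"
      using \<open>b \<in> A\<close> by blast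
  qed
  have surj: "t \<in> dist x ` A" if t: "0 \<le> t" "t \<le> dist x y" for t
  proof (rule ccontr)
    assume nt: "t \<notin> dist x ` A"
    \<comment> \<open>\<open>a\<close> and \<open>b\<close> are the ends of the gap around
      \<open>t\<close>; they exist since the set of levels is closed.\<close>
    have "\<exists>m\<in>dist x ` A \<inter> {0..t}. \<forall>u\<in>dist x ` A \<inter> {0..t}. u \<le> m"
      by (rule compact_attains_sup) (use closed AM(2) t in \<open>force simp: image_iff closed_Int_compact\<close>)+
    then obtain a where a: "a \<in> A" "dist x a \<le> t"
        "\<And>u. u \<in> A \<Longrightarrow> dist x u \<le> t \<Longrightarrow> dist x u \<le> dist x a"
      by force
    have "\<exists>m\<in>dist x ` A \<inter> {t..dist x y}. \<forall>u\<in>dist x ` A \<inter> {t..dist x y}. m \<le> u"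
      by (rule compact_attains_inf) (use closed AM(3) t in \<open>force simp: image_iff closed_Int_compact\<close>)+
    then obtain b where b: "b \<in> A" "t \<le> dist x b"
        "\<And>u. u \<in> A \<Longrightarrow> t \<le> dist x u \<Longrightarrow> dist x b \<le> dist x u"
      using le by force
    have ab: "dist x a < t" "t < dist x b"
      using a b nt by (metis imageI order_less_le)+
    then have dab: "dist a b = dist x b - dist x a" "a \<noteq> b"
      using iso[OF a(1) b(1)] by auto
    obtain z where z: "z \<in> M" "z \<noteq> a" "z \<noteq> b" "dist a z + dist z b = dist a b"
      using between_exists[of a b] a(1) b(1) AM(1) dab(2) by blast
    have xz: "dist x z = dist x a + dist a z"
      using dist_triangle[of x z a] dist_triangle[of x b z] z(4) dab(1) by simp
    \<comment> \<open>No level of \<open>A\<close> lies strictly between those of \<open>a\<close>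
      and \<open>b\<close>, so \<open>u\<close> lies beyond one of the two and triangle inequalities
      through \<open>a\<close> and \<open>b\<close> fix its distance to \<open>z\<close>.\<close>
    have "dist u z = \<bar>dist x u - dist x z\<bar>" if "u \<in> A" for u
    proof (cases "dist x u \<le> t")
      case True
      then show ?thesis
        using dist_triangle[of u z a] dist_triangle[of u b z] iso[OF that a(1)] iso[OF that b(1)]
          a(3)[OF that] ab z(4) dab(1) xz zero_le_dist[of a z] by linarith
    next
      case False
      then show ?thesis
        using dist_triangle[of u z b] dist_triangle[of u a z] iso[OF that a(1)] iso[OF that b(1)]
          b(3)[OF that] ab z(4) dab(1) xz zero_le_dist[of z b] dist_commute[of z b] dist_commute[of z a]
        by linarith
    qed
    moreover from this have "dist z u = \<bar>dist x z - dist x u\<bar>" if "u \<in> A" for u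
      using that by (simp add: dist_commute abs_minus_commute)
    moreover have "dist x z \<le> dist x y"
      using xz z(4) dab(1) le[OF b(1)] zero_le_dist[of z b] by linarith
    moreover have "dist z z = \<bar>dist x z - dist x z\<bar>"
      by simp
    ultimately have "insert z A \<in> \<C>"
      using A z(1) unfolding \<C>_def by blast
    then have "z \<in> A"
      using maximal[of "insert z A"] by blast
    moreover have "0 < dist a z" "0 < dist z b"
      using z(2,3) by auto
    ultimately show False
      using a(3)[of z] b(3)[of z] xz z(4) dab(1) by linarith
  qed
  define g where "g = inv_into A (dist x)"
  have g: "g t \<in> A" "dist x (g t) = t" if "t \<in> {0..dist x y}" for t
    using surj[of t] that by (auto simp: g_def inv_into_into f_inv_into_f)
  have inj: "u = v" if "u \<in> A" "v \<in> A" "dist x u = dist x v" for u v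
    using iso[OF that(1,2)] that(3) by simp
  have geo: "geodesic_on {0..dist x y} g M"
    unfolding geodesic_on_def distance_preserving_on_def
    using g(1) AM(1) iso[OF g(1) g(1)] g(2) by (auto simp: is_interval_cc dist_real_def)
  have "g 0 = x" "g (dist x y) = y"
    using inj[OF g(1) AM(2)] inj[OF g(1) AM(3)] g(2) by auto
  with geo have "0 \<le> dist x y \<and> geodesic_on {0..dist x y} g M \<and> g 0 = x \<and> g (dist x y) = y"
    by simp
  then show "\<exists>a b g. a \<le> b \<and> geodesic_on {a..b} g M \<and> g a = x \<and> g b = y"
    by blast
qed

end

section \<open>Reduction to the locale\<close>

text \<open>The chain with parameters \<open>0, t, 1\<close> bounds the length of a curve from
  below, so a curve shorter than \<open>dist x y + e\<close> contains only points of excess below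
  \<open>e\<close>.\<close>

lemma length_space_almost_geodesic:
  assumes "length_space M" "x \<in> M" "y \<in> M" "0 < e"
  obtains g where "path g" "path_image g \<subseteq> M" "pathstart g = x" "pathfinish g = y"
    "\<And>z. z \<in> path_image g \<Longrightarrow> dist x z + dist z y < dist x y + e"
proof -
  have "ennreal (dist x y) < ennreal (dist x y + e)"
    using assms(4) by (intro ennreal_lessI add_nonneg_pos) auto
  then have "(INF g\<in>{g. path g \<and> path_image g \<subseteq> M \<and> pathstart g = x \<and> pathfinish g = y}.
      curve_length g) < ennreal (dist x y + e)"
    using assms(1-3) unfolding length_space_def by simp
  then obtain g where g: "path g" "path_image g \<subseteq> M" "pathstart g = x" "pathfinish g = y"
      "curve_length g < ennreal (dist x y + e)"
    unfolding INF_less_iff by blast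
  have "dist x (g t) + dist (g t) y < dist x y + e" if "t \<in> {0..1}" for t
  proof -
    have "(\<Sum>i<length [0, t, 1] - 1. ennreal (dist (g ([0, t, 1] ! i)) (g ([0, t, 1] ! Suc i))))
        \<le> curve_length g"
      unfolding curve_length_def by (rule SUP_upper) (use that in auto)
    then have "ennreal (dist x (g t) + dist (g t) y) \<le> curve_length g"
      using g(3,4) by (simp add: pathstart_def pathfinish_def numeral_2_eq_2)
    then show ?thesis
      using g(5) by (meson ennreal_less_iff le_less_trans zero_le_dist add_nonneg_nonneg)
  qed
  then show ?thesis
    using that[OF g(1-4)] unfolding path_image_def by blast
qed

text \<open>A distance-preserving map is injective, hence an isometry onto its image, to which
  homogeneity applies.\<close>

lemma all_set_homogeneous_extension:
  assumes "all_set_homogeneous M" "A \<subseteq> M" "f ` A \<subseteq> M" "distance_preserving_on A f"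
  obtains F where "F ` M \<subseteq> M" "distance_preserving_on M F" "\<And>x. x \<in> A \<Longrightarrow> F x = f x"
proof -
  have "inj_on f A"
    using assms(4) unfolding distance_preserving_on_def inj_on_def by (metis dist_eq_0_iff)
  then have "isometry_betw f A (f ` A)"
    using assms(4) by (simp add: isometry_betw_def inj_on_imp_bij_betw)
  then obtain F where "isometry_betw F M M" "\<forall>x\<in>A. F x = f x"
    using assms(1-3) unfolding all_set_homogeneous_def by blast
  then show ?thesis
    using that[of F] by (auto simp: isometry_betw_def bij_betw_def)
qed

theorem proposition5p1:
  fixes M :: "'a::metric_space set"
  assumes "complete M"
    and "all_set_homogeneous M"
    and "length_space M"
  shows "geodesic_space M"
proof -
  interpret homogeneous_length_space M
  proof
    show "complete M"
      by (rule assms(1))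
    show "\<exists>F. F ` M \<subseteq> M \<and> distance_preserving_on M F \<and> (\<forall>x\<in>A. F x = f x)"
      if "A \<subseteq> M" "f ` A \<subseteq> M" "distance_preserving_on A f" for A f
      using all_set_homogeneous_extension[OF assms(2) that] by metis
    show "\<exists>g. path g \<and> path_image g \<subseteq> M \<and> pathstart g = x \<and> pathfinish g = y \<and>
        (\<forall>z\<in>path_image g. dist x z + dist z y < dist x y + e)"
      if "x \<in> M" "y \<in> M" "0 < e" for x y e
      using length_space_almost_geodesic[OF assms(3) that] by metis
  qed
  show ?thesis
    by (rule geodesic_space)
qed

end
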